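(* Let $H\in\mathbb{S}^n$, let $A_i\in\mathbb{R}^{m_i\times n}$ for $i=1,\ldots,k$, and define the stacked matrix $\mathcal{A}:=[A_1^{\mathrm T},\ldots,A_k^{\mathrm T}]^{\mathrm T}$. Assume that $\mathcal{A}$ has full row rank and fewer than $n$ rows, and let $Z$ have orthonormal columns spanning $\mathcal{N}(\mathcal{A})=\bigcap_{i=1}^k\mathcal{N}(A_i)$. Then $$\lambda_{\min}(Z^{\mathrm T}HZ)=\sup_{\rho\in\mathbb{R}}\lambda_{\min}\left(H+\rho\sum_{i=1}^kA_i^{\mathrm T}A_i\right),$$ $$\lambda_{\max}(Z^{\mathrm T}HZ)=\inf_{\rho\in\mathbb{R}}\lambda_{\max}\left(H-\rho\sum_{i=1}^kA_i^{\mathrm T}A_i\right).$$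
   Context: $\mathbb{S}^n$ denotes the space of $n\times n$ real symmetric matrices, $\mathcal{N}(\cdot)$ the null space, and $\lambda_{\min}(M)$, $\lambda_{\max}(M)$ the smallest and largest eigenvalues of a symmetric matrix $M$. *)

theory Defs
  imports
    "HOL-Library.Extended_Real"
    "Jordan_Normal_Form.Spectral_Radius"
    "Jordan_Normal_Form.Matrix_Kernel"
    "Jordan_Normal_Form.DL_Rank"
begin

text \<open>These are applied to real symmetric matrices of positive dimension only: there the
  set of real eigenvalues is finite and nonempty and contains all the eigenvalues.\<close>

definition lambda_min :: "real mat \<Rightarrow> real" where
  "lambda_min M = Min (spectrum M)"

definition lambda_max :: "real mat \<Rightarrow> real" where
  "lambda_max M = Max (spectrum M)"

text \<open>The blocks are indexed from 1: \<open>stack_rows n A k\<close> has \<open>A 1\<close> on top and \<open>A k\<close> at the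
  bottom. The number \<open>n\<close> of columns is needed to type the empty stack.\<close>

primrec stack_rows :: "nat \<Rightarrow> (nat \<Rightarrow> 'a::zero mat) \<Rightarrow> nat \<Rightarrow> 'a mat" where
  "stack_rows n A 0 = 0\<^sub>m 0 n"
| "stack_rows n A (Suc k) = stack_rows n A k @\<^sub>r A (Suc k)"

text \<open>The matrix type is not an instance of \<open>comm_monoid_add\<close>, since its zero depends on the
  dimensions, so the sum is taken in the module of \<open>n \<times> n\<close> matrices.\<close>

definition gram_sum :: "nat \<Rightarrow> (nat \<Rightarrow> real mat) \<Rightarrow> nat \<Rightarrow> real mat" where
  "gram_sum n A k = finsum (module_mat TYPE(real) n n) (\<lambda>i. (A i)\<^sup>T * A i) {1..k}"

definition full_row_rank :: "'a::field mat \<Rightarrow> bool" where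
  "full_row_rank A \<longleftrightarrow> vec_space.rank (dim_row A) A = dim_row A"

definition orthonormal_cols :: "real mat \<Rightarrow> bool" where
  "orthonormal_cols Z \<longleftrightarrow>
     (\<forall>i < dim_col Z. \<forall>j < dim_col Z. col Z i \<bullet> col Z j = (if i = j then 1 else 0))"

definition cols_span :: "'a::field mat \<Rightarrow> 'a vec set \<Rightarrow> bool" where
  "cols_span Z W \<longleftrightarrow> vec_space.col_space (dim_row Z) Z = W"

lemma stack_rows_carrier:
  assumes "\<And>i. i \<in> {1..k} \<Longrightarrow> A i \<in> carrier_mat (m i) n"
  shows "stack_rows n A k \<in> carrier_mat (\<Sum>i = 1..k. m i) n"
  using assms
proof (induction k)
  case (Suc k)
  then have "stack_rows n A k \<in> carrier_mat (\<Sum>i = 1..k. m i) n"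
    and "A (Suc k) \<in> carrier_mat (m (Suc k)) n"
    by auto
  then show ?case
    using carrier_append_rows by fastforce
qed simp

text \<open>The null space of the stacked matrix is the intersection of the null spaces of the
  blocks; the factor \<open>carrier_vec n\<close> only matters for \<open>k = 0\<close>.\<close>

lemma mat_kernel_stack_rows:
  fixes A :: "nat \<Rightarrow> 'a::comm_ring_1 mat"
  assumes "\<And>i. i \<in> {1..k} \<Longrightarrow> A i \<in> carrier_mat (m i) n"
  shows "mat_kernel (stack_rows n A k) = carrier_vec n \<inter> (\<Inter>i\<in>{1..k}. mat_kernel (A i))"
  using assms
proof (induction k)
  case 0
  show ?case by (auto simp: mat_kernel_def)
next
  case (Suc k)
  define M where "M = (\<Sum>i = 1..k. m i)"
  have S: "stack_rows n A k \<in> carrier_mat M n"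
    unfolding M_def by (rule stack_rows_carrier) (use Suc.prems in auto)
  have B: "A (Suc k) \<in> carrier_mat (m (Suc k)) n"
    using Suc.prems by auto
  have IH: "mat_kernel (stack_rows n A k) = carrier_vec n \<inter> (\<Inter>i\<in>{1..k}. mat_kernel (A i))"
    using Suc by auto
  have zero: "0\<^sub>v (M + m (Suc k)) = (0\<^sub>v M @\<^sub>v 0\<^sub>v (m (Suc k)) :: 'a vec)"
    by (rule eq_vecI) auto
  have iff: "(stack_rows n A k @\<^sub>r A (Suc k)) *\<^sub>v v = 0\<^sub>v (M + m (Suc k)) \<longleftrightarrow>
      stack_rows n A k *\<^sub>v v = 0\<^sub>v M \<and> A (Suc k) *\<^sub>v v = 0\<^sub>v (m (Suc k))"
    if v: "v \<in> carrier_vec n" for v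
    unfolding mat_mult_append[OF S B v] zero
    by (rule append_vec_eq[where n = M]) (use S v in auto)
  have "mat_kernel (stack_rows n A (Suc k)) = mat_kernel (stack_rows n A k) \<inter> mat_kernel (A (Suc k))"
    using iff by (auto simp: mat_kernel[OF S] mat_kernel[OF B]
        mat_kernel[OF carrier_append_rows[OF S B]])
  then show ?case
    by (auto simp: IH atLeastAtMostSuc_conv)
qed

end

theory Submission
  imports Defs "HOL-Analysis.Function_Topology"
begin

text \<open>By Rayleigh's principle \<open>lambda_min M\<close> is the minimum of the quadratic form of a symmetric
  \<open>M\<close> on the unit sphere. On the null space of the stack the penalty \<open>\<rho> G\<close>, with
  \<open>G\<close> the sum of the Gram matrices, vanishes, so no \<open>\<rho>\<close> lifts the minimum above
  \<open>lambda_min (Z\<^sup>T * H * Z)\<close>. If all penalised minima stayed below some smaller \<open>c\<close>, the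
  nested nonempty compact sets of unit vectors \<open>v\<close> with
  \<open>v \<bullet> (H *\<^sub>v v) + r * (v \<bullet> (G *\<^sub>v v)) \<le> c\<close>, for natural numbers
  \<open>r\<close>, would have a common point; it lies in the null space, where the form of \<open>H\<close>
  exceeds \<open>c\<close>. The maximum is treated by passing to \<open>-H\<close>.\<close>

section \<open>Compactness of the unit sphere and quadratic forms on it\<close>

text \<open>Tychonoff's theorem, carried over from \<open>product_topology\<close> to the topology
  of the function type.\<close>

lemma compact_Pi_UNIV:
  fixes S :: "'i \<Rightarrow> 'b::topological_space set"
  assumes "\<And>i. compact (S i)"
  shows "compact {x. \<forall>i. x i \<in> S i}"
proof -
  have "compactin (product_topology (\<lambda>_. euclidean) UNIV) (PiE UNIV S)"
    using assms by (simp add: compactin_PiE)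
  then show ?thesis
    by (simp add: euclidean_product_topology PiE_def Pi_def)
qed

lemma quad_form_vec:
  assumes "M \<in> carrier_mat n n"
  shows "vec n x \<bullet> (M *\<^sub>v vec n x) = (\<Sum>i<n. x i * (\<Sum>j<n. M $$ (i, j) * x j))"
  using assms by (auto simp: scalar_prod_def atLeast0LessThan intro!: sum.cong)

lemma continuous_on_quad_form_vec:
  fixes M :: "real mat"
  assumes "M \<in> carrier_mat n n"
  shows "continuous_on S (\<lambda>x. vec n x \<bullet> (M *\<^sub>v vec n x))"
  unfolding quad_form_vec[OF assms]
  by (intro continuous_intros continuous_on_subset[OF continuous_on_product_coordinates]) auto

text \<open>The type of vectors carries no topology, so compactness is taken from the product topology
  on functions. The entries at \<open>n\<close> and beyond are irrelevant and merely bounded.\<close>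

definition unit_sphere_fun :: "nat \<Rightarrow> (nat \<Rightarrow> real) set" where
  "unit_sphere_fun n = {x. (\<forall>i. x i \<in> {-1..1}) \<and> vec n x \<bullet> vec n x = 1}"

lemma compact_unit_sphere_fun: "compact (unit_sphere_fun n)"
proof -
  \<comment> \<open>The identity matrix turns the squared norm into a quadratic form, so that its
    continuity is already known.\<close>
  have "closed {x::nat\<Rightarrow>real. vec n x \<bullet> (1\<^sub>m n *\<^sub>v vec n x) = 1}"
    by (intro closed_Collect_eq continuous_on_quad_form_vec continuous_intros) auto
  then have "compact ({x::nat\<Rightarrow>real. \<forall>i. x i \<in> {-1..1}} \<inter> {x. vec n x \<bullet> (1\<^sub>m n *\<^sub>v vec n x) = 1})"
    by (intro compact_Int_closed compact_Pi_UNIV) auto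
  then show ?thesis
    by (simp add: unit_sphere_fun_def Int_def)
qed

text \<open>The box [-1, 1] loses no unit vector, since the square of an entry is at most the sum of
  all squares, which is 1. This carries results on the compact set of functions over to
  vectors.\<close>

lemma vec_unit_sphere_fun:
  "vec n ` unit_sphere_fun n = {v \<in> carrier_vec n. v \<bullet> v = 1}"
proof (intro equalityI subsetI)
  fix v :: "real vec" assume v: "v \<in> {v \<in> carrier_vec n. v \<bullet> v = 1}"
  define x where "x = (\<lambda>i. if i < n then v $ i else 0)"
  have vx: "v = vec n x"
    using v by (auto simp: x_def)
  have sum1: "(\<Sum>i<n. (v $ i)\<^sup>2) = 1"
    using v by (auto simp: scalar_prod_def power2_eq_square atLeast0LessThan)
  have "(v $ i)\<^sup>2 \<le> 1" if "i < n" for i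
    unfolding sum1[symmetric] using that by (intro member_le_sum) auto
  then have "x i \<in> {-1..1}" for i
    by (simp add: x_def) (metis abs_le_iff abs_square_le_1 minus_le_iff)
  then show "v \<in> vec n ` unit_sphere_fun n"
    using v by (auto simp: unit_sphere_fun_def vx)
qed (auto simp: unit_sphere_fun_def)

lemma quad_form_attains_min:
  fixes M :: "real mat"
  assumes M: "M \<in> carrier_mat n n" and n: "n > 0"
  obtains v where "v \<in> carrier_vec n" "v \<bullet> v = 1"
    "\<And>w. w \<in> carrier_vec n \<Longrightarrow> w \<bullet> w = 1 \<Longrightarrow> v \<bullet> (M *\<^sub>v v) \<le> w \<bullet> (M *\<^sub>v w)"
proof -
  have "unit_vec n 0 \<in> vec n ` unit_sphere_fun n"
    using n unfolding vec_unit_sphere_fun by auto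
  then have "unit_sphere_fun n \<noteq> {}" by auto
  then obtain x where x: "x \<in> unit_sphere_fun n"
    "\<And>y. y \<in> unit_sphere_fun n \<Longrightarrow> vec n x \<bullet> (M *\<^sub>v vec n x) \<le> vec n y \<bullet> (M *\<^sub>v vec n y)"
    using continuous_attains_inf[OF compact_unit_sphere_fun _ continuous_on_quad_form_vec[OF M]]
    by blast
  show thesis
  proof (rule that)
    show "vec n x \<in> carrier_vec n" "vec n x \<bullet> vec n x = 1"
      using x(1) by (auto simp: unit_sphere_fun_def)
    fix w :: "real vec" assume "w \<in> carrier_vec n" "w \<bullet> w = 1"
    then have "w \<in> vec n ` unit_sphere_fun n"
      unfolding vec_unit_sphere_fun by auto
    then show "vec n x \<bullet> (M *\<^sub>v vec n x) \<le> w \<bullet> (M *\<^sub>v w)"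
      using x(2) by auto
  qed
qed

lemma quad_form_penalty_limit:
  fixes H G :: "real mat"
  assumes H: "H \<in> carrier_mat n n" and G: "G \<in> carrier_mat n n"
    and psd: "\<And>v. v \<in> carrier_vec n \<Longrightarrow> 0 \<le> v \<bullet> (G *\<^sub>v v)"
    and ex: "\<And>r::nat. \<exists>v\<in>carrier_vec n. v \<bullet> v = 1 \<and> v \<bullet> (H *\<^sub>v v) + real r * (v \<bullet> (G *\<^sub>v v)) \<le> c"
  obtains v where "v \<in> carrier_vec n" "v \<bullet> v = 1" "v \<bullet> (G *\<^sub>v v) = 0" "v \<bullet> (H *\<^sub>v v) \<le> c"
proof -
  define q where "q M x = vec n x \<bullet> (M *\<^sub>v vec n x)" for M :: "real mat" and x
  have psd': "0 \<le> q G x" for x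
    using psd by (simp add: q_def)
  have "unit_sphere_fun n \<inter> (\<Inter>r\<in>UNIV. {x. q H x + real r * q G x \<le> c}) \<noteq> {}"
  proof (rule compact_imp_fip_image[OF compact_unit_sphere_fun])
    show "closed {x. q H x + real r * q G x \<le> c}" for r
      unfolding q_def
      by (intro closed_Collect_le continuous_on_add continuous_on_mult continuous_on_const
          continuous_on_quad_form_vec[OF H] continuous_on_quad_form_vec[OF G])
    fix I :: "nat set" assume "finite I"
    \<comment> \<open>The sets shrink as the penalty grows, because the form of \<open>G\<close> is
      nonnegative. A point of the set for an upper bound \<open>s\<close> of \<open>I\<close>
      therefore lies in all the sets of the finite family.\<close>
    then obtain s where s: "\<And>r. r \<in> I \<Longrightarrow> r \<le> s"
      by (auto simp: finite_nat_set_iff_bounded_le)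
    obtain v where v: "v \<in> carrier_vec n" "v \<bullet> v = 1"
      "v \<bullet> (H *\<^sub>v v) + real s * (v \<bullet> (G *\<^sub>v v)) \<le> c"
      using ex by blast
    then obtain x where x: "x \<in> unit_sphere_fun n" "v = vec n x"
      using vec_unit_sphere_fun[of n] by blast
    have "q H x + real r * q G x \<le> c" if "r \<in> I" for r
    proof -
      have "real r * q G x \<le> real s * q G x"
        using s[OF that] psd' by (intro mult_right_mono) auto
      then show ?thesis
        using v(3) by (simp add: q_def x(2))
    qed
    with x(1) show "unit_sphere_fun n \<inter> (\<Inter>r\<in>I. {x. q H x + real r * q G x \<le> c}) \<noteq> {}"
      by blast
  qed
  then obtain x where x: "x \<in> unit_sphere_fun n"
    and le: "\<And>r. q H x + real r * q G x \<le> c"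
    by blast
  \<comment> \<open>A positive value would make the penalty exceed every bound as \<open>r\<close>
    grows. The bound on the form of \<open>H\<close> is then the case \<open>r = 0\<close>.\<close>
  have "q G x = 0"
  proof (rule ccontr)
    assume "q G x \<noteq> 0"
    then have "q G x > 0" using psd'[of x] by simp
    then obtain r :: nat where "c - q H x < real r * q G x"
      using ex_less_of_nat_mult by blast
    with le[of r] show False by simp
  qed
  then show thesis
    using x le[of 0] by (intro that[of "vec n x"]) (auto simp: unit_sphere_fun_def q_def)
qed

section \<open>Rayleigh's principle\<close>

lemma quad_form_add_smult:
  fixes M :: "real mat"
  assumes M: "M \<in> carrier_mat n n" and sym: "M\<^sup>T = M"
    and v: "v \<in> carrier_vec n" and u: "u \<in> carrier_vec n"
  shows "(v + t \<cdot>\<^sub>v u) \<bullet> (M *\<^sub>v (v + t \<cdot>\<^sub>v u)) =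
    v \<bullet> (M *\<^sub>v v) + 2 * t * (u \<bullet> (M *\<^sub>v v)) + t\<^sup>2 * (u \<bullet> (M *\<^sub>v u))"
proof -
  have "(M\<^sup>T *\<^sub>v v) \<bullet> u = v \<bullet> (M *\<^sub>v u)"
    by (rule transpose_vec_mult_scalar[OF M u v])
  then have swap: "v \<bullet> (M *\<^sub>v u) = u \<bullet> (M *\<^sub>v v)"
    using M u v by (subst comm_scalar_prod[of u n]) (auto simp: sym)
  have 1: "M *\<^sub>v (v + t \<cdot>\<^sub>v u) = M *\<^sub>v v + t \<cdot>\<^sub>v (M *\<^sub>v u)"
    using M u v by (simp add: mult_add_distrib_mat_vec[of _ n n] mult_mat_vec)
  show ?thesis
    unfolding 1 using M u v
    by (simp add: add_scalar_prod_distrib[of _ n] scalar_prod_add_distrib[of _ n] swap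
        power2_eq_square algebra_simps)
qed

text \<open>A minimiser of the form on the unit sphere is an eigenvector for the minimal value
  \<open>l\<close>. By homogeneity \<open>l\<close> bounds the form from below on all vectors, and
  evaluating this at eigenvectors shows that no real eigenvalue is smaller. The argument also yields
  the existence of a real eigenvalue.\<close>

lemma symmetric_mat_rayleigh:
  assumes M: "M \<in> carrier_mat n n" and sym: "M\<^sup>T = M" and n: "n > 0"
  obtains v where "v \<in> carrier_vec n" "v \<bullet> v = 1" "M *\<^sub>v v = lambda_min M \<cdot>\<^sub>v v"
    "\<And>w. w \<in> carrier_vec n \<Longrightarrow> lambda_min M * (w \<bullet> w) \<le> w \<bullet> (M *\<^sub>v w)"
proof -
  obtain v where v: "v \<in> carrier_vec n" "v \<bullet> v = 1"
    and v_min: "\<And>w. w \<in> carrier_vec n \<Longrightarrow> w \<bullet> w = 1 \<Longrightarrow> v \<bullet> (M *\<^sub>v v) \<le> w \<bullet> (M *\<^sub>v w)"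
    using quad_form_attains_min[OF M n] by blast
  define l where "l = v \<bullet> (M *\<^sub>v v)"
  have l_le: "l * (w \<bullet> w) \<le> w \<bullet> (M *\<^sub>v w)" if w: "w \<in> carrier_vec n" for w
  proof (cases "w = 0\<^sub>v n")
    case True
    then show ?thesis using M by simp
  next
    case False
    define s where "s = w \<bullet> w"
    have s: "s > 0"
      using False conjugate_square_greater_0_vec[OF w]
      by (simp add: s_def)
    have "l \<le> ((1 / sqrt s) \<cdot>\<^sub>v w) \<bullet> (M *\<^sub>v ((1 / sqrt s) \<cdot>\<^sub>v w))"
      unfolding l_def using w s by (intro v_min) (auto simp: s_def[symmetric])
    also have "\<dots> = (w \<bullet> (M *\<^sub>v w)) / s"
      using w M s by (simp add: mult_mat_vec[of _ n n] smult_scalar_prod_distrib[of _ n]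
          scalar_prod_smult_distrib[of _ n])
    finally show ?thesis
      using s by (simp add: s_def[symmetric] field_simps)
  qed
  define u where "u = M *\<^sub>v v - l \<cdot>\<^sub>v v"
  have u: "u \<in> carrier_vec n"
    using M v by (auto simp: u_def)
  define a where "a = u \<bullet> u"
  define b where "b = u \<bullet> (M *\<^sub>v u) - l * a"
  \<comment> \<open>Only the last \<open>u\<close> is unfolded: the left side is the product of
    \<open>u\<close> with the residual, which is \<open>u\<close> itself.\<close>
  have ua: "u \<bullet> (M *\<^sub>v v) - l * (u \<bullet> v) = a"
    unfolding a_def using M v u
    by (subst (4) u_def) (simp add: scalar_prod_minus_distrib[of _ n])
  \<comment> \<open>Minimality of \<open>l\<close> along the line through \<open>v\<close> in the direction of the residual \<open>u\<close>: the
    linear term must vanish, which forces \<open>u = 0\<close>.\<close>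
  have quad: "0 \<le> 2 * t * a + t\<^sup>2 * b" for t
  proof -
    have "l * ((v + t \<cdot>\<^sub>v u) \<bullet> (v + t \<cdot>\<^sub>v u)) \<le> (v + t \<cdot>\<^sub>v u) \<bullet> (M *\<^sub>v (v + t \<cdot>\<^sub>v u))"
      using u v by (intro l_le) auto
    moreover have "(v + t \<cdot>\<^sub>v u) \<bullet> (v + t \<cdot>\<^sub>v u) = 1 + 2 * t * (u \<bullet> v) + t\<^sup>2 * a"
      using quad_form_add_smult[of "1\<^sub>m n" n v u t] u v by (simp add: a_def)
    ultimately have "l * (1 + 2 * t * (u \<bullet> v) + t\<^sup>2 * a) \<le>
        l + 2 * t * (u \<bullet> (M *\<^sub>v v)) + t\<^sup>2 * (u \<bullet> (M *\<^sub>v u))"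
      by (simp add: quad_form_add_smult[OF M sym v(1) u] l_def)
    then show ?thesis
      unfolding ua[symmetric] b_def by (simp add: algebra_simps)
  qed
  have "a = 0"
  proof (rule ccontr)
    assume "a \<noteq> 0"
    then have a: "a > 0"
      using conjugate_square_ge_0_vec[of u] by (simp add: a_def)
    \<comment> \<open>The quadratic is tested at \<open>t = - s\<close>, with \<open>s\<close> close
      to its minimiser \<open>a / b\<close> up to sign; the added 1 in the denominator covers
      \<open>b = 0\<close>.\<close>
    have b: "b \<ge> 0"
      using l_le[OF u] by (simp add: a_def b_def)
    define s where "s = a / (b + 1)"
    have s: "s > 0" "a = s * (b + 1)"
      using a b by (auto simp: s_def field_simps)
    have "0 \<le> 2 * (- s) * a + (- s)\<^sup>2 * b"
      by (rule quad)
    also have "\<dots> = - (s\<^sup>2 * (b + 2))"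
      unfolding s(2) by (simp add: algebra_simps power2_eq_square)
    also have "\<dots> < 0"
      using s(1) b by simp
    finally show False by simp
  qed
  then have "u = 0\<^sub>v n"
    using conjugate_square_eq_0_vec[OF u] by (simp add: a_def)
  then have ev: "M *\<^sub>v v = l \<cdot>\<^sub>v v"
    using M v unfolding u_def
    by (metis carrier_matD(1) carrier_vecD dim_mult_mat_vec eq_vecI index_minus_vec(1)
        index_smult_vec index_zero_vec(1) right_minus_eq)
  have "lambda_min M = l"
    unfolding lambda_min_def
  proof (rule Min_eqI)
    show "finite (spectrum M)" by (rule card_finite_spectrum[OF M])
    have "v \<noteq> 0\<^sub>v n" using v by auto
    then show "l \<in> spectrum M"
      using ev v M by (auto simp: spectrum_def eigenvalue_def eigenvector_def)
    fix y assume "y \<in> spectrum M"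
    then obtain w where w: "w \<in> carrier_vec n" "w \<noteq> 0\<^sub>v n" "M *\<^sub>v w = y \<cdot>\<^sub>v w"
      using M by (auto simp: spectrum_def eigenvalue_def eigenvector_def)
    then have "w \<bullet> w > 0"
      using conjugate_square_greater_0_vec[OF w(1)] by simp
    moreover have "l * (w \<bullet> w) \<le> y * (w \<bullet> w)"
      using l_le[OF w(1)] w by simp
    ultimately show "l \<le> y" by simp
  qed
  then show thesis
    using that[OF v] ev l_le by simp
qed

section \<open>Negation, transposes and scalar multiples\<close>

lemma spectrum_uminus:
  fixes M :: "'a::field mat"
  assumes M: "M \<in> carrier_mat n n"
  shows "spectrum (- M) = uminus ` spectrum M"
proof -
  \<comment> \<open>Stated for an arbitrary \<open>N\<close>, since one inclusion takes
    \<open>M\<close> and the other takes \<open>- M\<close>.\<close>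
  have *: "- k \<in> spectrum (- N)" if k: "k \<in> spectrum N" and N: "N \<in> carrier_mat n n" for k and N :: "'a mat"
  proof -
    obtain v where v: "v \<in> carrier_vec n" "v \<noteq> 0\<^sub>v n" "N *\<^sub>v v = k \<cdot>\<^sub>v v"
      using k N unfolding spectrum_def eigenvalue_def eigenvector_def by auto
    have "(- N) *\<^sub>v v = (- k) \<cdot>\<^sub>v v"
      using v N by (auto simp: v(3))
    with v N show ?thesis
      by (auto simp: spectrum_def eigenvalue_def eigenvector_def)
  qed
  show ?thesis
  proof (intro equalityI subsetI)
    fix k assume "k \<in> spectrum (- M)"
    then have "- k \<in> spectrum M"
      using *[of k "- M"] M by simp
    then show "k \<in> uminus ` spectrum M"
      by (metis image_eqI minus_minus)
  qed (use * M in auto)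
qed

text \<open>Negation reverses the order on the spectrum. Symmetry and \<open>n > 0\<close> enter
  through Rayleigh's principle, which makes the spectrum nonempty, so that \<open>Max\<close> and
  \<open>Min\<close> are meaningful.\<close>

lemma lambda_max_uminus:
  assumes M: "M \<in> carrier_mat n n" and sym: "M\<^sup>T = M" and n: "n > 0"
  shows "lambda_max M = - lambda_min (- M)"
proof -
  obtain v where "v \<in> carrier_vec n" "v \<bullet> v = 1" "M *\<^sub>v v = lambda_min M \<cdot>\<^sub>v v"
    using symmetric_mat_rayleigh[OF M sym n] by blast
  then have "lambda_min M \<in> spectrum M"
    using M by (auto simp: spectrum_def eigenvalue_def eigenvector_def)
  then have "spectrum M \<noteq> {}" by blast
  with card_finite_spectrum(1)[OF M] show ?thesis
    by (simp add: lambda_max_def lambda_min_def spectrum_uminus[OF M] flip: minus_Max_eq_Min)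
qed

lemma transpose_congruence:
  fixes H :: "'a::comm_semiring_0 mat"
  assumes H: "H \<in> carrier_mat n n" "H\<^sup>T = H" and Z: "Z \<in> carrier_mat n p"
  shows "(Z\<^sup>T * H * Z)\<^sup>T = Z\<^sup>T * H * Z"
proof -
  have "(Z\<^sup>T * H * Z)\<^sup>T = Z\<^sup>T * (Z\<^sup>T * H)\<^sup>T"
    by (rule transpose_mult[of _ p n _ p]) (use H Z in auto)
  also have "(Z\<^sup>T * H)\<^sup>T = H * Z"
    using transpose_mult[of "Z\<^sup>T" p n H n] H Z by simp
  also have "Z\<^sup>T * (H * Z) = Z\<^sup>T * H * Z"
    by (rule assoc_mult_mat[symmetric, of _ p n _ n _ p]) (use H Z in auto)
  finally show ?thesis .
qed

lemma transpose_smult_mat: "(c \<cdot>\<^sub>m M)\<^sup>T = c \<cdot>\<^sub>m M\<^sup>T"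
  by (intro eq_matI) auto

lemma smult_mat_mult_vec:
  fixes M :: "'a::comm_semiring_0 mat"
  assumes "M \<in> carrier_mat nr nc" "v \<in> carrier_vec nc"
  shows "(c \<cdot>\<^sub>m M) *\<^sub>v v = c \<cdot>\<^sub>v (M *\<^sub>v v)"
  using assms by (intro eq_vecI) auto

section \<open>The sum of the Gram matrices\<close>

lemma gram_sum_0: "gram_sum n A 0 = 0\<^sub>m n n"
proof -
  interpret abelian_group "module_mat TYPE(real) n n" by (rule abelian_group_mat)
  show ?thesis by (simp add: gram_sum_def module_mat_simps)
qed

lemma gram_sum_carrier:
  assumes "\<And>i. i \<in> {1..k} \<Longrightarrow> A i \<in> carrier_mat (m i) n"
  shows "gram_sum n A k \<in> carrier_mat n n"
proof -
  interpret abelian_group "module_mat TYPE(real) n n" by (rule abelian_group_mat)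
  have "(\<lambda>i. (A i)\<^sup>T * A i) \<in> {1..k} \<rightarrow> carrier (module_mat TYPE(real) n n)"
    using assms by (force simp: module_mat_simps)
  from finsum_closed[OF this] show ?thesis
    by (simp add: gram_sum_def module_mat_simps)
qed

text \<open>Replaces the module sum by a recursion on \<open>k\<close>, on which the inductions for
  the transpose and the quadratic form run.\<close>

lemma gram_sum_Suc:
  assumes "\<And>i. i \<in> {1..Suc k} \<Longrightarrow> A i \<in> carrier_mat (m i) n"
  shows "gram_sum n A (Suc k) = (A (Suc k))\<^sup>T * A (Suc k) + gram_sum n A k"
proof -
  interpret abelian_group "module_mat TYPE(real) n n" by (rule abelian_group_mat)
  have f: "(\<lambda>i. (A i)\<^sup>T * A i) \<in> {1..k} \<rightarrow> carrier (module_mat TYPE(real) n n)"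
    using assms by (force simp: module_mat_simps)
  have B: "(A (Suc k))\<^sup>T * A (Suc k) \<in> carrier (module_mat TYPE(real) n n)"
    using assms[of "Suc k"] by (auto simp: module_mat_simps)
  have ivl: "{1..Suc k} = insert (Suc k) {1..k}"
    by auto
  show ?thesis
    unfolding gram_sum_def ivl
    by (subst finsum_insert) (use f B in \<open>auto simp: module_mat_simps\<close>)
qed

lemma transpose_gram_sum:
  assumes "\<And>i. i \<in> {1..k} \<Longrightarrow> A i \<in> carrier_mat (m i) n"
  shows "(gram_sum n A k)\<^sup>T = gram_sum n A k"
  using assms
proof (induction k)
  case 0
  show ?case by (auto simp: gram_sum_0)
next
  case (Suc k)
  have Suc_eq: "gram_sum n A (Suc k) = (A (Suc k))\<^sup>T * A (Suc k) + gram_sum n A k"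
    by (rule gram_sum_Suc) (fact Suc.prems)
  have B: "A (Suc k) \<in> carrier_mat (m (Suc k)) n"
    using Suc.prems by auto
  have "((A (Suc k))\<^sup>T * A (Suc k))\<^sup>T = (A (Suc k))\<^sup>T * A (Suc k)"
    using transpose_mult[of "(A (Suc k))\<^sup>T" n "m (Suc k)" "A (Suc k)" n] B by simp
  moreover have "(A (Suc k))\<^sup>T * A (Suc k) \<in> carrier_mat n n"
    using B by auto
  moreover have "gram_sum n A k \<in> carrier_mat n n"
    by (rule gram_sum_carrier[where m = m]) (use Suc.prems in auto)
  ultimately show ?case
    using Suc by (simp add: Suc_eq transpose_add[of _ n n])
qed

text \<open>Moving each transpose across the scalar product leaves a squared norm. As a sum of
  squares the form is nonnegative, and it vanishes exactly on the common null space of the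
  blocks.\<close>

lemma quad_form_gram_sum:
  assumes "\<And>i. i \<in> {1..k} \<Longrightarrow> A i \<in> carrier_mat (m i) n" and v: "v \<in> carrier_vec n"
  shows "v \<bullet> (gram_sum n A k *\<^sub>v v) = (\<Sum>i=1..k. (A i *\<^sub>v v) \<bullet> (A i *\<^sub>v v))"
  using assms(1)
proof (induction k)
  case 0
  have "0\<^sub>m n n *\<^sub>v v = 0\<^sub>v n" using v by auto
  with v show ?case by (simp add: gram_sum_0)
next
  case (Suc k)
  have Suc_eq: "gram_sum n A (Suc k) = (A (Suc k))\<^sup>T * A (Suc k) + gram_sum n A k"
    by (rule gram_sum_Suc) (fact Suc.prems)
  have B: "A (Suc k) \<in> carrier_mat (m (Suc k)) n"
    using Suc.prems by auto
  have "((A (Suc k))\<^sup>T *\<^sub>v (A (Suc k) *\<^sub>v v)) \<bullet> v = (A (Suc k) *\<^sub>v v) \<bullet> (A (Suc k) *\<^sub>v v)"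
    by (rule transpose_vec_mult_scalar[OF B v]) (use B v in auto)
  then have "v \<bullet> (((A (Suc k))\<^sup>T * A (Suc k)) *\<^sub>v v) = (A (Suc k) *\<^sub>v v) \<bullet> (A (Suc k) *\<^sub>v v)"
    using B v by (subst comm_scalar_prod[of v n]) (auto simp: assoc_mult_mat_vec[of _ n "m (Suc k)"])
  moreover have "(A (Suc k))\<^sup>T * A (Suc k) \<in> carrier_mat n n"
    using B by auto
  moreover have "gram_sum n A k \<in> carrier_mat n n"
    by (rule gram_sum_carrier[where m = m]) (use Suc.prems in auto)
  moreover have "v \<bullet> (gram_sum n A k *\<^sub>v v) = (\<Sum>i=1..k. (A i *\<^sub>v v) \<bullet> (A i *\<^sub>v v))"
    using Suc by auto
  ultimately show ?case
    using v by (simp del: assoc_mult_mat_vec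
        add: Suc_eq add_mult_distrib_mat_vec[of _ n n] scalar_prod_add_distrib[of _ n])
qed

section \<open>Nontrivial null space of a wide matrix\<close>

text \<open>Padding with zero rows gives a square matrix whose last row is zero. It is singular, and
  any kernel vector of it is annihilated by the original rows.\<close>

lemma wide_mat_kernel_nontrivial:
  fixes A :: "'a::idom mat"
  assumes A: "A \<in> carrier_mat r n" and r: "r < n"
  obtains v where "v \<in> mat_kernel A" "v \<noteq> 0\<^sub>v n"
proof -
  define B where "B = mat n n (\<lambda>(i, j). if i < r then A $$ (i, j) else 0)"
  have B: "B \<in> carrier_mat n n" by (simp add: B_def)
  have "B\<^sup>T *\<^sub>v unit_vec n (n - 1) = 0\<^sub>v n"
    using r by (intro eq_vecI) (auto simp: B_def)
  moreover have "unit_vec n (n - 1) \<noteq> (0\<^sub>v n :: 'a vec)"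
    using r by (auto simp: vec_eq_iff intro!: exI[of _ "n - 1"])
  ultimately have "det (B\<^sup>T) = 0"
    using B by (intro det_0_iff_vec_prod_zero[of _ n, THEN iffD2])
      (auto intro!: exI[of _ "unit_vec n (n - 1)"])
  then have "det B = 0"
    using det_transpose[OF B] by simp
  then obtain v where v: "v \<in> carrier_vec n" "v \<noteq> 0\<^sub>v n" "B *\<^sub>v v = 0\<^sub>v n"
    using det_0_iff_vec_prod_zero[OF B] by blast
  have "A *\<^sub>v v = 0\<^sub>v r"
  proof (rule eq_vecI)
    fix i assume "i < dim_vec (0\<^sub>v r :: 'a vec)"
    then have i: "i < r" by simp
    then have "row B i = row A i"
      using A r by (intro eq_vecI) (auto simp: B_def)
    then show "(A *\<^sub>v v) $ i = 0\<^sub>v r $ i"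
      using arg_cong[OF v(3), of "\<lambda>w. w $ i"] A B i r by simp
  qed (use A in auto)
  with v A show thesis
    by (intro that) (auto simp: mat_kernel_def)
qed

section \<open>Compression to the null space as the limit of penalties\<close>

text \<open>\<open>Z\<close> is an isometry onto the zero set of the form of \<open>G\<close>, so
  the Rayleigh quotients of \<open>Z\<^sup>T * H * Z\<close> are those of \<open>H\<close> on that
  set. Leaving \<open>H\<close> arbitrary lets the lemma serve for \<open>- H\<close> too. In the
  extended reals the supremum needs no separate boundedness proof.\<close>

lemma lambda_min_compression_eq_SUP:
  fixes H G Z :: "real mat"
  assumes H: "H \<in> carrier_mat n n" "H\<^sup>T = H" and G: "G \<in> carrier_mat n n" "G\<^sup>T = G"
    and psd: "\<And>v. v \<in> carrier_vec n \<Longrightarrow> 0 \<le> v \<bullet> (G *\<^sub>v v)"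
    and Z: "Z \<in> carrier_mat n p" and ZZ: "Z\<^sup>T * Z = 1\<^sub>m p" and p: "p > 0"
    and range: "{v \<in> carrier_vec n. v \<bullet> (G *\<^sub>v v) = 0} = {Z *\<^sub>v y | y. y \<in> carrier_vec p}"
  shows "ereal (lambda_min (Z\<^sup>T * H * Z)) = (SUP \<rho>::real. ereal (lambda_min (H + \<rho> \<cdot>\<^sub>m G)))"
proof -
  let ?C = "Z\<^sup>T * H * Z"
  have C: "?C \<in> carrier_mat p p" using H Z by auto
  have C_sym: "?C\<^sup>T = ?C"
    by (rule transpose_congruence[OF H Z])
  have adj: "(Z *\<^sub>v y) \<bullet> w = y \<bullet> (Z\<^sup>T *\<^sub>v w)" if "y \<in> carrier_vec p" "w \<in> carrier_vec n" for y w
    using transpose_vec_mult_scalar[of "Z\<^sup>T" p n w y] Z that by simp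
  have Z_quad: "(Z *\<^sub>v y) \<bullet> (H *\<^sub>v (Z *\<^sub>v y)) = y \<bullet> (?C *\<^sub>v y)" if y: "y \<in> carrier_vec p" for y
  proof -
    have Zy: "Z *\<^sub>v y \<in> carrier_vec n"
      using y Z by auto
    have "?C *\<^sub>v y = Z\<^sup>T *\<^sub>v (H *\<^sub>v (Z *\<^sub>v y))"
      using assoc_mult_mat_vec[of "Z\<^sup>T * H" p n Z p y] assoc_mult_mat_vec[of "Z\<^sup>T" p n H n "Z *\<^sub>v y"]
        Zy y Z H by simp
    then show ?thesis
      using adj[OF y, of "H *\<^sub>v (Z *\<^sub>v y)"] H Zy by simp
  qed
  have Z_norm: "(Z *\<^sub>v y) \<bullet> (Z *\<^sub>v y) = y \<bullet> y" if y: "y \<in> carrier_vec p" for y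
    using adj[OF y, of "Z *\<^sub>v y"] assoc_mult_mat_vec[of "Z\<^sup>T" p n Z p y] y Z ZZ by simp
  have M: "H + \<rho> \<cdot>\<^sub>m G \<in> carrier_mat n n" "(H + \<rho> \<cdot>\<^sub>m G)\<^sup>T = H + \<rho> \<cdot>\<^sub>m G" for \<rho>
    using H G by (auto simp: transpose_add[of _ n n] transpose_smult_mat)
  have M_quad: "v \<bullet> ((H + \<rho> \<cdot>\<^sub>m G) *\<^sub>v v) = v \<bullet> (H *\<^sub>v v) + \<rho> * (v \<bullet> (G *\<^sub>v v))"
    if v: "v \<in> carrier_vec n" for v \<rho>
    using H G v by (simp add: add_mult_distrib_mat_vec[of _ n n] scalar_prod_add_distrib[of _ n]
        smult_mat_mult_vec[of _ n n])
  obtain y where y: "y \<in> carrier_vec p" "y \<bullet> y = 1" "?C *\<^sub>v y = lambda_min ?C \<cdot>\<^sub>v y"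
    and C_min: "\<And>w. w \<in> carrier_vec p \<Longrightarrow> lambda_min ?C * (w \<bullet> w) \<le> w \<bullet> (?C *\<^sub>v w)"
    using symmetric_mat_rayleigh[OF C C_sym p] by blast
  have Zy: "Z *\<^sub>v y \<in> carrier_vec n" "(Z *\<^sub>v y) \<bullet> (G *\<^sub>v (Z *\<^sub>v y)) = 0"
    using range y(1) by blast+
  \<comment> \<open>The unit vector \<open>y\<close> has an image of norm 1, which is impossible in
    dimension 0.\<close>
  have n: "n > 0"
  proof (rule ccontr)
    assume "\<not> n > 0"
    then have "Z *\<^sub>v y = 0\<^sub>v n"
      using Zy(1) Z by (intro eq_vecI) auto
    then have "(Z *\<^sub>v y) \<bullet> (Z *\<^sub>v y) = 0" by simp
    then show False
      using Z_norm[OF y(1)] y(2) by simp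
  qed
  \<comment> \<open>The test vector is the image of a minimal unit eigenvector of the compression,
    where the penalty vanishes for every \<rho>.\<close>
  have upper: "lambda_min (H + \<rho> \<cdot>\<^sub>m G) \<le> lambda_min ?C" for \<rho>
  proof -
    have "lambda_min (H + \<rho> \<cdot>\<^sub>m G) * ((Z *\<^sub>v y) \<bullet> (Z *\<^sub>v y)) \<le>
        (Z *\<^sub>v y) \<bullet> ((H + \<rho> \<cdot>\<^sub>m G) *\<^sub>v (Z *\<^sub>v y))"
      by (rule symmetric_mat_rayleigh[OF M n]) (use Zy(1) in blast)
    then show ?thesis
      using y by (simp add: M_quad[OF Zy(1)] Zy(2) Z_norm[OF y(1)] Z_quad[OF y(1)])
  qed
  have lower: "\<exists>\<rho>. c < lambda_min (H + \<rho> \<cdot>\<^sub>m G)" if c: "c < lambda_min ?C" for c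
  proof (rule ccontr)
    assume neg: "\<nexists>\<rho>. c < lambda_min (H + \<rho> \<cdot>\<^sub>m G)"
    \<comment> \<open>Natural penalties suffice; the witness is a unit eigenvector for the smallest
      eigenvalue, at which the penalised form equals that eigenvalue.\<close>
    have penalised: "\<exists>v\<in>carrier_vec n. v \<bullet> v = 1 \<and> v \<bullet> (H *\<^sub>v v) + real r * (v \<bullet> (G *\<^sub>v v)) \<le> c"
      for r :: nat
    proof -
      obtain v where v: "v \<in> carrier_vec n" "v \<bullet> v = 1"
        "(H + real r \<cdot>\<^sub>m G) *\<^sub>v v = lambda_min (H + real r \<cdot>\<^sub>m G) \<cdot>\<^sub>v v"
        by (rule symmetric_mat_rayleigh[OF M n])
      have "v \<bullet> (H *\<^sub>v v) + real r * (v \<bullet> (G *\<^sub>v v)) = lambda_min (H + real r \<cdot>\<^sub>m G)"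
        using v(2) by (simp add: M_quad[OF v(1), symmetric] v)
      with v(1,2) neg show ?thesis
        by (auto simp: not_less)
    qed
    obtain v where v: "v \<in> carrier_vec n" "v \<bullet> v = 1" "v \<bullet> (G *\<^sub>v v) = 0" "v \<bullet> (H *\<^sub>v v) \<le> c"
      by (rule quad_form_penalty_limit[OF H(1) G(1) psd penalised])
    then obtain w where w: "w \<in> carrier_vec p" "v = Z *\<^sub>v w"
      using range by blast
    have "lambda_min ?C \<le> c"
      using C_min[OF w(1)] v by (simp add: w(2) Z_norm[OF w(1)] Z_quad[OF w(1)])
    with c show False by simp
  qed
  have "(SUP \<rho>::real. ereal (lambda_min (H + \<rho> \<cdot>\<^sub>m G))) = ereal (lambda_min ?C)"
  proof (rule SUP_eqI)
    fix u :: ereal assume u: "\<And>\<rho>::real. \<rho> \<in> UNIV \<Longrightarrow> ereal (lambda_min (H + \<rho> \<cdot>\<^sub>m G)) \<le> u"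
    show "ereal (lambda_min ?C) \<le> u"
    \<comment> \<open>An extended bound \<open>u\<close> may be infinite, so it is compared through
      the real numbers \<open>c\<close> above it.\<close>
    proof (rule ereal_le_real)
      fix c assume "u \<le> ereal c"
      with u have "lambda_min (H + \<rho> \<cdot>\<^sub>m G) \<le> c" for \<rho>
        by (metis UNIV_I ereal_less_eq(3) order_trans)
      then have "lambda_min ?C \<le> c"
        using lower by (meson linorder_not_less)
      then show "ereal (lambda_min ?C) \<le> ereal c" by simp
    qed
  qed (use upper in auto)
  then show ?thesis by simp
qed

theorem corollary2p9:
  fixes n k p :: nat
    and m :: "nat \<Rightarrow> nat"
    and H Z :: "real mat"
    and A :: "nat \<Rightarrow> real mat"
  assumes H: "H \<in> carrier_mat n n" and H_sym: "H\<^sup>T = H"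
    and A: "\<And>i. i \<in> {1..k} \<Longrightarrow> A i \<in> carrier_mat (m i) n"
    and full_rank: "full_row_rank (stack_rows n A k)"
    and fewer_rows: "dim_row (stack_rows n A k) < n"
    and Z: "Z \<in> carrier_mat n p"
    and Z_orthonormal: "orthonormal_cols Z"
    and Z_span: "cols_span Z (mat_kernel (stack_rows n A k))"
  shows "ereal (lambda_min (Z\<^sup>T * H * Z)) =
           (SUP \<rho>::real. ereal (lambda_min (H + \<rho> \<cdot>\<^sub>m gram_sum n A k)))
       \<and> ereal (lambda_max (Z\<^sup>T * H * Z)) =
           (INF \<rho>::real. ereal (lambda_max (H - \<rho> \<cdot>\<^sub>m gram_sum n A k)))"
proof -
  let ?S = "stack_rows n A k" and ?G = "gram_sum n A k"
  have "?S \<in> carrier_mat (\<Sum>i = 1..k. m i) n"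
    by (rule stack_rows_carrier) (fact A)
  then have S: "?S \<in> carrier_mat (dim_row ?S) n"
    by auto
  have kernel_S: "mat_kernel ?S = carrier_vec n \<inter> (\<Inter>i\<in>{1..k}. mat_kernel (A i))"
    by (rule mat_kernel_stack_rows) (fact A)
  have G: "?G \<in> carrier_mat n n" "?G\<^sup>T = ?G"
    by (rule gram_sum_carrier transpose_gram_sum, fact A)+
  have G_quad: "v \<bullet> (?G *\<^sub>v v) = (\<Sum>i=1..k. (A i *\<^sub>v v) \<bullet> (A i *\<^sub>v v))" if "v \<in> carrier_vec n" for v
    by (rule quad_form_gram_sum[OF _ that]) (fact A)
  have sq_nonneg: "0 \<le> w \<bullet> w" for w :: "real vec"
    using conjugate_square_ge_0_vec[of w] by simp
  have psd: "0 \<le> v \<bullet> (?G *\<^sub>v v)" if "v \<in> carrier_vec n" for v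
    using that by (auto simp: G_quad intro!: sum_nonneg sq_nonneg)
  \<comment> \<open>The column space is the range of \<open>Z\<close>, which puts the null space
    into the form that the compression lemma expects.\<close>
  have "mat_kernel ?S = {v \<in> carrier_vec n. \<exists>y\<in>carrier_vec p. Z *\<^sub>v y = v}"
    using Z_span vec_space.col_space_eq[OF Z] Z by (simp add: cols_span_def)
  also have "\<dots> = {Z *\<^sub>v y | y. y \<in> carrier_vec p}"
    using Z by auto
  finally have range_Z: "mat_kernel ?S = {Z *\<^sub>v y | y. y \<in> carrier_vec p}" .
  have "v \<bullet> (?G *\<^sub>v v) = 0 \<longleftrightarrow> v \<in> mat_kernel ?S" if v: "v \<in> carrier_vec n" for v
  proof -
    have "v \<bullet> (?G *\<^sub>v v) = 0 \<longleftrightarrow> (\<forall>i\<in>{1..k}. (A i *\<^sub>v v) \<bullet> (A i *\<^sub>v v) = 0)"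
      unfolding G_quad[OF v] by (rule sum_nonneg_eq_0_iff) (auto intro: sq_nonneg)
    also have "\<dots> \<longleftrightarrow> (\<forall>i\<in>{1..k}. v \<in> mat_kernel (A i))"
    proof (rule ball_cong[OF refl])
      fix i assume "i \<in> {1..k}"
      then have Ai: "A i \<in> carrier_mat (m i) n" by (rule A)
      then have "A i *\<^sub>v v \<in> carrier_vec (m i)" using v by auto
      then show "(A i *\<^sub>v v) \<bullet> (A i *\<^sub>v v) = 0 \<longleftrightarrow> v \<in> mat_kernel (A i)"
        using conjugate_square_eq_0_vec[of "A i *\<^sub>v v" "m i"] v by (simp add: mat_kernel[OF Ai])
    qed
    also have "\<dots> \<longleftrightarrow> v \<in> mat_kernel ?S"
      using v unfolding kernel_S by blast
    finally show ?thesis .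
  qed
  moreover have "mat_kernel ?S \<subseteq> carrier_vec n"
    using mat_kernel[OF S] by auto
  ultimately have range: "{v \<in> carrier_vec n. v \<bullet> (?G *\<^sub>v v) = 0} = {Z *\<^sub>v y | y. y \<in> carrier_vec p}"
    unfolding range_Z[symmetric] by blast
  \<comment> \<open>A nonzero null vector forces \<open>Z\<close> to have a column. Hence the
    compression has positive dimension and its extreme eigenvalues are meaningful.\<close>
  obtain v where "v \<in> mat_kernel ?S" "v \<noteq> 0\<^sub>v n"
    using wide_mat_kernel_nontrivial[OF S fewer_rows] by blast
  then obtain y where y: "y \<in> carrier_vec p" "Z *\<^sub>v y \<noteq> 0\<^sub>v n"
    using range_Z by auto
  have p: "p > 0"
  proof (rule ccontr)
    assume "\<not> p > 0"
    with y Z have "Z *\<^sub>v y = 0\<^sub>v n"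
      by (intro eq_vecI) (auto simp: scalar_prod_def)
    with y(2) show False by simp
  qed
  have ZZ: "Z\<^sup>T * Z = 1\<^sub>m p"
    using Z Z_orthonormal by (intro eq_matI) (auto simp: orthonormal_cols_def)
  \<comment> \<open>The slots for \<open>H\<close> stay open: \<open>H\<close> gives the first
    identity and \<open>- H\<close> the second.\<close>
  note SUP = lambda_min_compression_eq_SUP[OF _ _ G psd Z ZZ p range]
  have n: "n > 0" using fewer_rows by simp
  have C: "Z\<^sup>T * H * Z \<in> carrier_mat p p" using H Z by auto
  have C_sym: "(Z\<^sup>T * H * Z)\<^sup>T = Z\<^sup>T * H * Z"
    by (rule transpose_congruence[OF H H_sym Z])
  have neg_sym: "(- H)\<^sup>T = - H"
    using H H_sym by (metis transpose_uminus)
  have neg_C: "- (Z\<^sup>T * H * Z) = Z\<^sup>T * (- H) * Z"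
    using H Z by simp
  \<comment> \<open>Negation turns the subtracted penalty into an added one, so the same \<rho>
    serves on both sides and the supremum for \<open>- H\<close> becomes the infimum.\<close>
  have max_eq: "lambda_max (H - \<rho> \<cdot>\<^sub>m ?G) = - lambda_min (- H + \<rho> \<cdot>\<^sub>m ?G)" for \<rho>
  proof -
    have "(H - \<rho> \<cdot>\<^sub>m ?G)\<^sup>T = H - \<rho> \<cdot>\<^sub>m ?G"
      using H H_sym G by (simp add: transpose_minus[of _ n n] transpose_smult_mat)
    moreover have "- (H - \<rho> \<cdot>\<^sub>m ?G) = - H + \<rho> \<cdot>\<^sub>m ?G"
      using H G by (intro eq_matI) auto
    moreover have "H - \<rho> \<cdot>\<^sub>m ?G \<in> carrier_mat n n"
      using G by auto
    ultimately show ?thesis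
      using lambda_max_uminus[of "H - \<rho> \<cdot>\<^sub>m ?G" n] n by simp
  qed
  have "ereal (lambda_max (Z\<^sup>T * H * Z)) = - ereal (lambda_min (Z\<^sup>T * (- H) * Z))"
    unfolding lambda_max_uminus[OF C C_sym p] neg_C by (rule uminus_ereal.simps(1)[symmetric])
  also have "\<dots> = - (SUP \<rho>::real. ereal (lambda_min (- H + \<rho> \<cdot>\<^sub>m ?G)))"
    using SUP[OF _ neg_sym] H by (simp only: uminus_carrier_iff_mat)
  also have "\<dots> = (INF \<rho>::real. ereal (lambda_max (H - \<rho> \<cdot>\<^sub>m ?G)))"
    by (simp add: max_eq flip: ereal_INF_uminus_eq)
  finally show ?thesis
    using SUP[OF H H_sym] by blast
qed

end
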